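(* Suppose future contacts during a window of length $\Delta$ form a Poisson process of rate $\lambda$ and each arrival has an independent mark $V\sim F^V$ supported on $[v_{\min},v_{\max}]$. Let $M_\Delta$ be the maximum arrival value in the window ($M_\Delta=-\infty$ if none arrives) and let $v_0\in[v_{\min},v_{\max}]$. Then, with a delay price $c_w$ per unit time, the value of waiting $Q_W(v_0,\Delta)=\mathbb E[\max\{v_0,M_\Delta\}]-c_w\Delta$ equals $$Q_W(v_0,\Delta)=v_0+\int_{v_0}^{v_{\max}}\bigl[1-e^{-\lambda\Delta(1-F^V(x))}\bigr]\,dx-c_w\Delta.$$
   Context: $F^V$ denotes the cumulative distribution function of the marks; marks are i.i.d. and independent of the arrival process. Here $v_0$ is a deterministic fallback value, $\lambda\ge0$, $\Delta\ge0$. *)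

theory Defs
  imports "HOL-Probability.Probability"
begin

text \<open>
  A Poisson process of given rate on the window \<open>[0, T]\<close>, as a counting process:
  \<open>N t\<close> is the number of arrivals in \<open>[0, t]\<close>. The Poisson weights are written out because
  \<^const>\<open>poisson_pmf\<close> is only specified for a strictly positive parameter, whereas the rate and
  the length of the window may be zero here (with \<open>0 ^ 0 = 1\<close>, parameter \<open>0\<close> gives the point mass
  at \<open>0\<close>). Paths are almost surely nondecreasing, so the subtraction on \<^typ>\<open>nat\<close> is not truncated.
\<close>

locale poisson_process_on = prob_space M
  for M :: "'a measure" and N :: "real \<Rightarrow> 'a \<Rightarrow> nat" and rate T :: real +
  assumes measurable_count:
      "\<And>t. t \<in> {0..T} \<Longrightarrow> N t \<in> measurable M (count_space UNIV)"
    and start_zero: "AE \<omega> in M. N 0 \<omega> = 0"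
    and paths_mono: "AE \<omega> in M. mono_on {0..T} (\<lambda>t. N t \<omega>)"
    and paths_right_continuous:
      "AE \<omega> in M. \<forall>t\<in>{0..<T}. continuous (at_right t) (\<lambda>s. N s \<omega>)"
    and independent_increments:
      "\<And>(n::nat) (t::nat \<Rightarrow> real).
        mono_on {..n} t \<Longrightarrow> t ` {..n} \<subseteq> {0..T} \<Longrightarrow>
        indep_vars (\<lambda>_. count_space UNIV) (\<lambda>i \<omega>. N (t (Suc i)) \<omega> - N (t i) \<omega>) {..<n}"
    and poisson_increments:
      "\<And>s t k. 0 \<le> s \<Longrightarrow> s \<le> t \<Longrightarrow> t \<le> T \<Longrightarrow>
        prob {\<omega> \<in> space M. N t \<omega> - N s \<omega> = k} =
          (rate * (t - s)) ^ k / fact k * exp (- (rate * (t - s)))"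

text \<open>
  \<open>V i\<close> is the mark of the \<open>(i + 1)\<close>-st arrival, so the marks seen in \<open>[0, \<Delta>]\<close> are the \<open>V i\<close>
  with \<open>i < N \<Delta>\<close>. In \<^typ>\<open>ereal\<close> the supremum of the empty set is \<open>-\<infinity>\<close>.
\<close>

definition max_arrival_value ::
    "(real \<Rightarrow> 'a \<Rightarrow> nat) \<Rightarrow> (nat \<Rightarrow> 'a \<Rightarrow> real) \<Rightarrow> real \<Rightarrow> 'a \<Rightarrow> ereal" where
  "max_arrival_value N V \<Delta> \<omega> = (SUP i\<in>{..<N \<Delta> \<omega>}. ereal (V i \<omega>))"

text \<open>The maximum with \<open>v\<^sub>0\<close> is always finite, so \<^const>\<open>real_of_ereal\<close> loses nothing.\<close>

definition value_of_waiting ::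
    "'a measure \<Rightarrow> (real \<Rightarrow> 'a \<Rightarrow> nat) \<Rightarrow> (nat \<Rightarrow> 'a \<Rightarrow> real) \<Rightarrow> real \<Rightarrow> real \<Rightarrow> real \<Rightarrow> real" where
  "value_of_waiting M N V c\<^sub>w v\<^sub>0 \<Delta> =
    (\<integral>\<omega>. real_of_ereal (max (ereal v\<^sub>0) (max_arrival_value N V \<Delta> \<omega>)) \<partial>M) - c\<^sub>w * \<Delta>"

end

theory Submission
  imports Defs
begin

text \<open>
  Let \<open>X\<close> be the maximum of \<open>v\<^sub>0\<close> and the marks seen in the window. Since \<open>X\<close> lies in
  \<open>[v\<^sub>0, v_max]\<close>, its expectation is \<open>v\<^sub>0\<close> plus the integral of its tail \<open>P(X > x)\<close> over
  \<open>[v\<^sub>0, v_max]\<close>. For \<open>x \<ge> v\<^sub>0\<close> the event \<open>X \<le> x\<close> says that all marks seen are at most \<open>x\<close>;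
  conditioning on the number of arrivals, its probability is the generating function of the
  Poisson distribution at \<open>F\<^sub>V x\<close>.
\<close>

text \<open>Taking the maximum with \<open>a\<close> makes the value finite even if
  \<open>n = 0\<close>, where the supremum is -infinity. Hence \<open>real_of_ereal\<close>
  preserves the order here, and the rest is the universal property of the supremum.\<close>

lemma real_of_ereal_max_SUP_le_iff:
  fixes f :: "nat \<Rightarrow> real"
  shows "real_of_ereal (max (ereal a) (SUP i\<in>{..<n}. ereal (f i))) \<le> x \<longleftrightarrow>
    a \<le> x \<and> (\<forall>i<n. f i \<le> x)"
proof -
  let ?S = "max (ereal a) (SUP i\<in>{..<n}. ereal (f i))"
  have finite: "\<bar>s\<bar> \<noteq> \<infinity>" if "s \<le> ereal b" "ereal a \<le> s" for s b
    using that by (cases s) auto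
  have real_le: "real_of_ereal s \<le> x \<longleftrightarrow> s \<le> ereal x" if "\<bar>s\<bar> \<noteq> \<infinity>" for s
    using that by (cases s) auto
  have "?S \<le> ereal (Max (insert a (f ` {..<n})))"
    by (auto intro!: SUP_least)
  moreover have "ereal a \<le> ?S" by (rule max.cobounded1)
  ultimately have "\<bar>?S\<bar> \<noteq> \<infinity>" by (rule finite)
  then have "real_of_ereal ?S \<le> x \<longleftrightarrow> ?S \<le> ereal x"
    by (rule real_le)
  then show ?thesis by (simp add: SUP_le_iff Ball_def)
qed

text \<open>Layer-cake formula: \<open>X - a\<close> is almost surely the length of the interval
  from \<open>a\<close> to \<open>X\<close>. Integrating over the sample space first, by Fubini,
  turns this length into the tail.\<close>

lemma (in prob_space) expectation_eq_tail_integral: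
  fixes X :: "'a \<Rightarrow> real"
  assumes X[measurable]: "random_variable borel X"
    and bounds: "AE \<omega> in M. X \<omega> \<in> {a..b}"
  shows "expectation X = a + (LBINT x:{a..b}. prob {\<omega> \<in> space M. x < X \<omega>})"
proof -
  interpret pair_sigma_finite M lborel ..
  define f where "f \<omega> x = (indicator {a..b} x * indicator {x<..} (X \<omega>) :: real)" for \<omega> x
  have f_alt: "f \<omega> x = (if a \<le> x \<and> x \<le> b \<and> x < X \<omega> then 1 else 0)" for \<omega> x
    by (auto simp: f_def)
  have f_measurable: "case_prod f \<in> borel_measurable (M \<Otimes>\<^sub>M lborel)"
    unfolding f_alt[abs_def] by measurable
  \<comment> \<open>This rectangle has finite measure and its indicator dominates \<open>f\<close>,
    which justifies Fubini.\<close>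
  have "integrable (M \<Otimes>\<^sub>M lborel) (indicator (space M \<times> {a..b}) :: _ \<Rightarrow> real)"
    by (rule integrable_real_indicator)
      (auto simp: lborel.emeasure_pair_measure_Times emeasure_space_1 emeasure_lborel_Icc_eq)
  then have "integrable (M \<Otimes>\<^sub>M lborel) (case_prod f)"
    by (rule Bochner_Integration.integrable_bound)
      (auto simp: f_alt space_pair_measure intro!: AE_I2 f_measurable)
  then have "(\<integral>x. \<integral>\<omega>. f \<omega> x \<partial>M \<partial>lborel) = (\<integral>\<omega>. \<integral>x. f \<omega> x \<partial>lborel \<partial>M)"
    by (rule Fubini_integral)
  also have "\<dots> = expectation (\<lambda>\<omega>. X \<omega> - a)"
  proof (rule integral_cong_AE)
    show "AE \<omega> in M. (\<integral>x. f \<omega> x \<partial>lborel) = X \<omega> - a"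
      using bounds
    proof eventually_elim
      case (elim \<omega>)
      \<comment> \<open>The condition \<open>x \<le> b\<close> is absorbed by
        \<open>X \<omega> \<le> b\<close>, and \<open>a \<le> X \<omega>\<close> makes the length
        exactly \<open>X \<omega> - a\<close>.\<close>
      then have "f \<omega> = indicator {a..<X \<omega>}" by (auto simp: f_alt fun_eq_iff)
      then show ?case using elim by simp
    qed
  qed (auto simp: f_alt)
  also have "\<dots> = expectation X - a"
  proof -
    have "AE \<omega> in M. norm (X \<omega>) \<le> \<bar>a\<bar> + \<bar>b\<bar>"
      using bounds by eventually_elim auto
    then have "integrable M X"
      by (rule integrable_const_bound) measurable
    then show ?thesis by (simp add: prob_space)
  qed
  finally have "expectation X - a = (\<integral>x. \<integral>\<omega>. f \<omega> x \<partial>M \<partial>lborel)" ..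
  also have "\<dots> = (LBINT x:{a..b}. prob {\<omega> \<in> space M. x < X \<omega>})"
  proof -
    have "(\<integral>\<omega>. indicator {x<..} (X \<omega>) \<partial>M) = prob {\<omega> \<in> space M. x < X \<omega>}" for x
    proof -
      have "(\<integral>\<omega>. indicat_real {x<..} (X \<omega>) \<partial>M) = (\<integral>\<omega>. indicat_real {\<omega> \<in> space M. x < X \<omega>} \<omega> \<partial>M)"
        by (rule Bochner_Integration.integral_cong) (auto simp: indicator_def)
      then show ?thesis by simp
    qed
    then show ?thesis by (simp add: f_def set_lebesgue_integral_def)
  qed
  finally show ?thesis by simp
qed

lemma (in prob_space) prob_all_le_iid:
  fixes V :: "nat \<Rightarrow> 'a \<Rightarrow> real"
  assumes indep: "indep_vars (\<lambda>_. borel) V UNIV"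
    and cdf: "\<And>i. cdf (distr M borel (V i)) = F"
  shows "prob {\<omega> \<in> space M. \<forall>i<n. V i \<omega> \<le> x} = F x ^ n"
\<comment> \<open>The product rule for independent variables needs a nonempty index set; for
  \<open>n = 0\<close> both sides are 1.\<close>
proof (cases "n = 0")
  case False
  have V[measurable]: "random_variable borel (V i)" for i
    using indep by (auto simp: indep_vars_def)
  have "prob (\<Inter>i\<in>{..<n}. V i -` {..x} \<inter> space M) = (\<Prod>i<n. prob (V i -` {..x} \<inter> space M))"
    by (rule indep_varsD[OF indep]) (use False in auto)
  also have "\<dots> = (\<Prod>i<n. F x)"
  proof (rule prod.cong)
    show "prob (V i -` {..x} \<inter> space M) = F x" for i
      unfolding cdf[of i, symmetric] cdf_def by (simp add: measure_distr)
  qed simp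
  also have "(\<Inter>i\<in>{..<n}. V i -` {..x} \<inter> space M) = {\<omega> \<in> space M. \<forall>i<n. V i \<omega> \<le> x}"
    using False by auto
  finally show ?thesis by simp
qed (simp add: prob_space)

text \<open>Splitting by the value of \<open>K\<close> gives the generating function of the Poisson
  distribution at \<open>p\<close>. Independence enters only between \<open>P n\<close> and
  \<open>K = n\<close> for the same \<open>n\<close>.\<close>

lemma (in prob_space) prob_poisson_compound_sums:
  fixes K :: "'a \<Rightarrow> nat" and p :: real
  assumes [measurable]: "\<And>n. {\<omega> \<in> space M. K \<omega> = n} \<in> events" "\<And>n. {\<omega> \<in> space M. P n \<omega>} \<in> events"
    and K: "\<And>n. prob {\<omega> \<in> space M. K \<omega> = n} = m ^ n / fact n * exp (- m)"
    and P: "\<And>n. prob {\<omega> \<in> space M. P n \<omega>} = p ^ n"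
    and indep: "\<And>n. prob ({\<omega> \<in> space M. P n \<omega>} \<inter> {\<omega> \<in> space M. K \<omega> = n}) =
      prob {\<omega> \<in> space M. P n \<omega>} * prob {\<omega> \<in> space M. K \<omega> = n}"
  shows "prob {\<omega> \<in> space M. P (K \<omega>) \<omega>} = exp (- m * (1 - p))"
proof -
  let ?A = "\<lambda>n. {\<omega> \<in> space M. P n \<omega>} \<inter> {\<omega> \<in> space M. K \<omega> = n}"
  have "(\<lambda>n. prob (?A n)) sums prob (\<Union>n. ?A n)"
    by (rule finite_measure_UNION) (auto simp: disjoint_family_on_def)
  also have "(\<Union>n. ?A n) = {\<omega> \<in> space M. P (K \<omega>) \<omega>}" by auto
  \<comment> \<open>The factors \<open>m ^ n\<close> and \<open>p ^ n\<close> merge, so that the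
    exponential series at \<open>m * p\<close> appears.\<close>
  also have "(\<lambda>n. prob (?A n)) = (\<lambda>n. (m * p) ^ n /\<^sub>R fact n * exp (- m))"
    by (simp add: indep K P field_simps)
  finally have "(\<lambda>n. (m * p) ^ n /\<^sub>R fact n * exp (- m)) sums prob {\<omega> \<in> space M. P (K \<omega>) \<omega>}" .
  moreover have "(\<lambda>n. (m * p) ^ n /\<^sub>R fact n * exp (- m)) sums (exp (m * p) * exp (- m))"
    by (intro sums_mult2 exp_converges)
  ultimately have "prob {\<omega> \<in> space M. P (K \<omega>) \<omega>} = exp (m * p) * exp (- m)"
    by (rule sums_unique2)
  then show ?thesis by (simp add: exp_add[symmetric] algebra_simps)
qed

lemma (in poisson_process_on) prob_count_eq:
  assumes "0 \<le> t" "t \<le> T"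
  shows "prob {\<omega> \<in> space M. N t \<omega> = k} = (rate * t) ^ k / fact k * exp (- (rate * t))"
proof -
  have [measurable]: "N t \<in> measurable M (count_space UNIV)" "N 0 \<in> measurable M (count_space UNIV)"
    using assms by (auto intro!: measurable_count)
  have "prob {\<omega> \<in> space M. N t \<omega> = k} = prob {\<omega> \<in> space M. N t \<omega> - N 0 \<omega> = k}"
    by (rule finite_measure_eq_AE) (use start_zero in \<open>auto elim!: eventually_mono\<close>)
  also have "\<dots> = (rate * t) ^ k / fact k * exp (- (rate * t))"
    using poisson_increments[of 0 t k] assms by simp
  finally show ?thesis .
qed

theorem proposition7:
  fixes M :: "'a measure"
    and N :: "real \<Rightarrow> 'a \<Rightarrow> nat"
    and V :: "nat \<Rightarrow> 'a \<Rightarrow> real"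
    and F\<^sub>V :: "real \<Rightarrow> real"
    and lam \<Delta> c\<^sub>w v\<^sub>0 v_min v_max :: real
  assumes "lam \<ge> 0" and "\<Delta> \<ge> 0"
    and arrivals: "poisson_process_on M N lam \<Delta>"
    and marks_indep: "prob_space.indep_vars M (\<lambda>_. borel) V UNIV"
    and marks_cdf: "\<And>i. cdf (distr M borel (V i)) = F\<^sub>V"
    and marks_support: "\<And>i. AE \<omega> in M. V i \<omega> \<in> {v_min..v_max}"
    and marks_indep_arrivals:
      "prob_space.indep_set M
        (sets (vimage_algebra (space M) (\<lambda>\<omega> i. V i \<omega>) (Pi\<^sub>M (UNIV :: nat set) (\<lambda>_. borel))))
        (sets (vimage_algebra (space M) (\<lambda>\<omega>. \<lambda>t\<in>{0..\<Delta>}. N t \<omega>)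
          (Pi\<^sub>M {0..\<Delta>} (\<lambda>_. count_space UNIV))))"
    and "v\<^sub>0 \<in> {v_min..v_max}"
  shows "value_of_waiting M N V c\<^sub>w v\<^sub>0 \<Delta> =
    v\<^sub>0 + (LBINT x:{v\<^sub>0..v_max}. 1 - exp (- lam * \<Delta> * (1 - F\<^sub>V x))) - c\<^sub>w * \<Delta>"
proof -
  interpret poisson_process_on M N lam \<Delta> by (fact arrivals)
  have V[measurable]: "V i \<in> borel_measurable M" for i
    using marks_indep by (auto simp: indep_vars_def)
  have N[measurable]: "N \<Delta> \<in> measurable M (count_space UNIV)"
    using \<open>\<Delta> \<ge> 0\<close> by (intro measurable_count) auto
  define X where "X \<omega> = real_of_ereal (max (ereal v\<^sub>0) (max_arrival_value N V \<Delta> \<omega>))" for \<omega>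
  \<comment> \<open>Measurability, bounds and tail of \<open>X\<close> all come from this
    description, which holds at every \<open>\<omega>\<close>.\<close>
  have X_le: "X \<omega> \<le> x \<longleftrightarrow> v\<^sub>0 \<le> x \<and> (\<forall>i<N \<Delta> \<omega>. V i \<omega> \<le> x)" for \<omega> x
    unfolding X_def max_arrival_value_def by (rule real_of_ereal_max_SUP_le_iff)
  have X[measurable]: "X \<in> borel_measurable M"
    by (rule borel_measurableI_le) (simp add: X_le)
  \<comment> \<open>The number of marks seen depends on \<open>\<omega>\<close>, so one null set
    must serve all \<open>i\<close>; countability provides it.\<close>
  have "AE \<omega> in M. \<forall>i. V i \<omega> \<in> {v_min..v_max}"
    using marks_support by (simp add: AE_all_countable)
  then have bounds: "AE \<omega> in M. X \<omega> \<in> {v\<^sub>0..v_max}"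
  proof eventually_elim
    case (elim \<omega>)
    then have "X \<omega> \<le> v_max" using assms(8) by (simp add: X_le)
    moreover have "v\<^sub>0 \<le> X \<omega>" using X_le[of \<omega> "X \<omega>"] by simp
    ultimately show ?case by simp
  qed
  have tail: "prob {\<omega> \<in> space M. x < X \<omega>} = 1 - exp (- lam * \<Delta> * (1 - F\<^sub>V x))" if "v\<^sub>0 \<le> x" for x
  proof -
    have "prob {\<omega> \<in> space M. \<forall>i<N \<Delta> \<omega>. V i \<omega> \<le> x} = exp (- (lam * \<Delta>) * (1 - F\<^sub>V x))"
    \<comment> \<open>Conditioning on the count \<open>N \<Delta>\<close>, with
      \<open>m = lam * \<Delta>\<close> and \<open>p\<close> the value of the mark distribution
      function at \<open>x\<close>.\<close>
    proof (rule prob_poisson_compound_sums[where P="\<lambda>n \<omega>. \<forall>i<n. V i \<omega> \<le> x"])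
      fix n
      let ?P = "{\<omega> \<in> space M. \<forall>i<n. V i \<omega> \<le> x}" and ?K = "{\<omega> \<in> space M. N \<Delta> \<omega> = n}"
      show "prob ?K = (lam * \<Delta>) ^ n / fact n * exp (- (lam * \<Delta>))"
        using \<open>\<Delta> \<ge> 0\<close> by (intro prob_count_eq) auto
      show "prob ?P = F\<^sub>V x ^ n"
        by (rule prob_all_le_iid[OF marks_indep marks_cdf])
      \<comment> \<open>Independence is given for the sigma-algebras of the whole mark sequence and
        the whole path. So \<open>?P\<close> and \<open>?K\<close> are exhibited as preimages of
        measurable sets of sequences and of paths.\<close>
      have "{v \<in> space (Pi\<^sub>M UNIV (\<lambda>_. borel)). \<forall>i<n. v i \<le> x} \<in> sets (Pi\<^sub>M (UNIV :: nat set) (\<lambda>_. borel))"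
        by measurable
      from in_vimage_algebra[OF this, of "\<lambda>\<omega> i. V i \<omega>" "space M"]
      have P: "?P \<in> sets (vimage_algebra (space M) (\<lambda>\<omega> i. V i \<omega>) (Pi\<^sub>M (UNIV :: nat set) (\<lambda>_. borel)))"
        by (rule back_subst[where P="\<lambda>A. A \<in> _"]) (auto simp: space_PiM)
      \<comment> \<open>The count is the path coordinate at the right endpoint, which lies in the
        index set since \<open>\<Delta> \<ge> 0\<close>.\<close>
      have "(\<lambda>v. v \<Delta>) -` {n} \<inter> space (Pi\<^sub>M {0..\<Delta>} (\<lambda>_. count_space UNIV))
          \<in> sets (Pi\<^sub>M {0..\<Delta>} (\<lambda>_. count_space UNIV))"
        using \<open>\<Delta> \<ge> 0\<close> by (intro measurable_sets[OF measurable_component_singleton]) auto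
      from in_vimage_algebra[OF this, of "\<lambda>\<omega>. \<lambda>t\<in>{0..\<Delta>}. N t \<omega>" "space M"]
      have K: "?K \<in> sets (vimage_algebra (space M) (\<lambda>\<omega>. \<lambda>t\<in>{0..\<Delta>}. N t \<omega>)
          (Pi\<^sub>M {0..\<Delta>} (\<lambda>_. count_space UNIV)))"
        by (rule back_subst[where P="\<lambda>A. A \<in> _"]) (use \<open>\<Delta> \<ge> 0\<close> in \<open>auto simp: space_PiM\<close>)
      show "prob (?P \<inter> ?K) = prob ?P * prob ?K"
        by (rule indep_setD[OF marks_indep_arrivals P K])
    qed measurable
    \<comment> \<open>As \<open>x\<close> is at least the fallback value,
      \<open>X \<omega> \<le> x\<close> constrains only the marks.\<close>
    moreover have "{\<omega> \<in> space M. x < X \<omega>} = space M - {\<omega> \<in> space M. \<forall>i<N \<Delta> \<omega>. V i \<omega> \<le> x}"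
      using that by (auto simp: X_le not_le[symmetric] simp del: not_le)
    ultimately show ?thesis by (simp add: prob_compl)
  qed
  have "(LBINT x:{v\<^sub>0..v_max}. prob {\<omega> \<in> space M. x < X \<omega>}) =
      (LBINT x:{v\<^sub>0..v_max}. 1 - exp (- lam * \<Delta> * (1 - F\<^sub>V x)))"
    by (rule set_lebesgue_integral_cong) (use tail in auto)
  then show ?thesis
    using expectation_eq_tail_integral[OF X bounds]
    unfolding value_of_waiting_def X_def by simp
qed

end
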